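(* Let $\alpha,\gamma\in\mathbb{C}$ be such that $\alpha,\ \gamma,\ \gamma-\alpha\notin\mathbb{Z}_{\le 0}$, and let ${}_1F_1(\alpha;\gamma;z)=\sum_{n=0}^{\infty}\frac{(\alpha)_n}{n!\,(\gamma)_n}z^n$ be the confluent hypergeometric function. Then the exponent of convergence $\lambda(F)$ of the zero sequence of ${}_1F_1(\alpha;\gamma;z)$ satisfies $\lambda(F)\le 1$.
   Context: Here $\mathbb{Z}_{\le 0}=\{0,-1,-2,\dots\}$ and $(\alpha)_n:=\alpha(\alpha+1)\cdots(\alpha+n-1)$ is the rising factorial, with $(\alpha)_0=1$. For $\gamma\notin\mathbb{Z}_{\le 0}$ the series defining ${}_1F_1(\alpha;\gamma;z)$ converges for every $z\in\mathbb{C}$ and defines an entire function of $z$. When $\alpha,\gamma,\gamma-\alpha\notin\mathbb{Z}_{\le 0}$, this function has infinitely many zeros in $\mathbb{C}$ (known fact). Let $\{z_n\}_{n\ge1}$ be the sequence of zeros of ${}_1F_1(\alpha;\gamma;z)$ in $\mathbb{C}$, with multiple zeros repeated according to multiplicity and arranged so that $|z_1|\le|z_2|\le\cdots$. The exponent of convergence of the zero sequence is $\lambda(F):=\inf\{\tau>0:\ \sum_{n}|z_n|^{-\tau}<\infty\}$. *)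

theory Defs
  imports "HOL-Complex_Analysis.Complex_Analysis"
begin

definition hyp1F1 :: "complex \<Rightarrow> complex \<Rightarrow> complex \<Rightarrow> complex" where
  "hyp1F1 \<alpha> \<gamma> z = (\<Sum>n. pochhammer \<alpha> n / (fact n * pochhammer \<gamma> n) * z ^ n)"

text \<open>
  For an entire function \<open>F\<close> that is not identically zero, \<open>zorder F w\<close> is the multiplicity of
  a zero \<open>w\<close> and is positive. The second condition therefore says that each zero is listed, and
  exactly as often as its multiplicity (\<open>card\<close> is 0 for infinite sets, so positivity also rules
  out infinite repetition). Indexing starts at 0.
\<close>

definition zero_sequence :: "(complex \<Rightarrow> complex) \<Rightarrow> (nat \<Rightarrow> complex) \<Rightarrow> bool" where
  "zero_sequence F zs \<longleftrightarrow>
     (\<forall>n. F (zs n) = 0) \<and>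
     (\<forall>w. F w = 0 \<longrightarrow> int (card {n. zs n = w}) = zorder F w) \<and>
     mono (\<lambda>n. norm (zs n))"

text \<open>
  The infimum is taken in the extended reals, so that it is \<open>\<infinity>\<close> when no exponent works; for an
  infimum in \<open>real\<close> the empty set would give an unspecified value. The notion is meant for
  sequences of nonzero numbers, since \<open>0 powr x = 0\<close>.
\<close>

definition exponent_of_convergence :: "(nat \<Rightarrow> complex) \<Rightarrow> ereal" where
  "exponent_of_convergence zs =
     Inf (ereal ` {\<tau>. \<tau> > 0 \<and> summable (\<lambda>n. norm (zs n) powr (-\<tau>))})"

end

theory Submission
  imports Defs "HOL-Real_Asymp.Real_Asymp"
begin

text \<open>
  The ratios \<open>(\<alpha> + n) / (\<gamma> + n)\<close> are bounded, by \<open>K\<close> say, so the \<open>n\<close>-th coefficient of the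
  series is at most \<open>K ^ n / n!\<close> in modulus and \<open>\<bar>F z\<bar> \<le> exp (K \<bar>z\<bar>)\<close>. Dividing \<open>F\<close> by
  its first \<open>n + 1\<close> zeros and applying the maximum principle on the disc of radius \<open>3 \<bar>z\<^sub>n\<bar>\<close> gives
  \<open>2 ^ (n + 1) \<le> exp (3 K \<bar>z\<^sub>n\<bar>)\<close>, so \<open>\<bar>z\<^sub>n\<bar>\<close> grows at least linearly in \<open>n\<close>.
\<close>

section \<open>Dividing zeros out of an entire function\<close>

lemma entire_eventually_nonzero:
  fixes f :: "complex \<Rightarrow> complex"
  assumes "f holomorphic_on UNIV" "f a \<noteq> 0"
  shows "eventually (\<lambda>z. f z \<noteq> 0) (at w)"
  using non_zero_neighbour_alt[OF assms(1) open_UNIV connected_UNIV UNIV_I UNIV_I assms(2)]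
  by (auto elim: eventually_mono)

text \<open>Orders add over a product that is not locally zero, and each linear factor contributes 1
  at its own root and 0 elsewhere.\<close>

lemma zorder_prod_linear:
  fixes zs :: "'i \<Rightarrow> complex"
  assumes "finite I"
  shows "zorder (\<lambda>z. \<Prod>i\<in>I. z - zs i) w = int (card {i \<in> I. zs i = w})"
proof -
  \<comment> \<open>A point off the finite set of roots shows that the product is not identically
    zero, so that \<open>zorder\<close> is additive.\<close>
  have "\<exists>a. a \<notin> zs ` I"
    by (rule ex_new_if_finite) (auto simp: assms infinite_UNIV_char_0)
  then obtain a where "(\<Prod>i\<in>I. a - zs i) \<noteq> 0"
    using assms by auto
  then have ev: "eventually (\<lambda>z. (\<Prod>i\<in>I. z - zs i) \<noteq> 0) (at w)"
    by (intro entire_eventually_nonzero) (auto intro!: holomorphic_intros)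
  have lin: "zorder (\<lambda>z. z - zs i) w = (if zs i = w then 1 else 0)" for i
  proof (cases "zs i = w")
    case True
    have "zorder (\<lambda>z. z - w) w = 1"
      by (rule zorder_eqI[where S = UNIV and g = "\<lambda>_. 1"]) auto
    then show ?thesis
      using True by simp
  qed (auto intro!: zorder_eq_0I analytic_intros)
  have "zorder (\<lambda>z. \<Prod>i\<in>I. z - zs i) w = (\<Sum>i\<in>I. zorder (\<lambda>z. z - zs i) w)"
    using ev by (intro zorder_prod_analytic) (auto intro!: analytic_intros)
  also have "\<dots> = int (card {i \<in> I. zs i = w})"
    using assms by (simp add: lin sum.If_cases Int_def)
  finally show ?thesis .
qed

text \<open>Induction on \<open>I\<close>, removing one root at a time. Counting repetitions against
  \<open>zorder\<close> ensures that the quotient obtained so far still vanishes at the next root,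
  even a repeated one.\<close>

lemma entire_factor_zeros:
  fixes f :: "complex \<Rightarrow> complex" and zs :: "'i \<Rightarrow> complex"
  assumes hol: "f holomorphic_on UNIV" and nz: "f a \<noteq> 0" and "finite I"
    and "\<And>i. i \<in> I \<Longrightarrow> int (card {j \<in> I. zs j = zs i}) \<le> zorder f (zs i)"
  obtains g where "g holomorphic_on UNIV" "\<And>z. f z = (\<Prod>i\<in>I. z - zs i) * g z"
proof -
  have "\<exists>g. g holomorphic_on UNIV \<and> (\<forall>z. f z = (\<Prod>i\<in>I. z - zs i) * g z)"
    using assms(3,4)
  proof (induction I rule: finite_induct)
    case empty
    then show ?case using hol by auto
  next
    case (insert k I)
    have "int (card {j \<in> I. zs j = zs i}) \<le> zorder f (zs i)" if "i \<in> I" for i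
    proof -
      have "card {j \<in> I. zs j = zs i} \<le> card {j \<in> insert k I. zs j = zs i}"
        using insert.hyps by (intro card_mono) auto
      then show ?thesis
        using insert.prems[of i] that by simp
    qed
    then obtain g where g: "g holomorphic_on UNIV" "\<And>z. f z = (\<Prod>i\<in>I. z - zs i) * g z"
      using insert.IH by blast
    let ?w = "zs k"
    have "{j \<in> insert k I. zs j = ?w} = insert k {j \<in> I. zs j = ?w}"
      by auto
    then have card: "card {j \<in> insert k I. zs j = ?w} = Suc (card {j \<in> I. zs j = ?w})"
      using insert.hyps by simp
    have ev: "eventually (\<lambda>z. f z \<noteq> 0) (at ?w)"
      by (rule entire_eventually_nonzero[OF hol nz])
    \<comment> \<open>The factors already split off use up all but at least one of the order of
      \<open>f\<close> at \<open>?w\<close>; the remainder falls to \<open>g\<close>.\<close>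
    have "zorder (\<lambda>z. (\<Prod>i\<in>I. z - zs i) * g z) ?w
          = zorder (\<lambda>z. \<Prod>i\<in>I. z - zs i) ?w + zorder g ?w"
      using ev g(1) by (intro zorder_times_analytic)
        (auto simp: g(2) intro!: analytic_intros elim: holomorphic_on_imp_analytic_at)
    also have "(\<lambda>z. (\<Prod>i\<in>I. z - zs i) * g z) = f"
      using g(2) by auto
    finally have "zorder g ?w > 0"
      using insert.prems[of k] card by (simp add: zorder_prod_linear[OF insert.hyps(1)])
    moreover have "frequently (\<lambda>z. g z \<noteq> 0) (at ?w)"
      by (rule eventually_frequently) (use ev in \<open>auto simp: g(2) elim!: eventually_mono\<close>)
    ultimately have gw: "g ?w = 0"
      using zorder_pos_iff[OF g(1)] by simp
    \<comment> \<open>The quotient of \<open>g\<close> by \<open>z - ?w\<close>, with the derivative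
      filling in the removable singularity.\<close>
    define h where "h = (\<lambda>z. if z = ?w then deriv g ?w else (g z - g ?w) / (z - ?w))"
    have "h holomorphic_on UNIV"
      unfolding h_def by (intro pole_lemma_open g open_UNIV)
    moreover have "g z = (z - ?w) * h z" for z
      using gw by (auto simp: h_def)
    then have "f z = (\<Prod>i\<in>insert k I. z - zs i) * h z" for z
      using insert.hyps by (simp add: g(2) mult_ac)
    ultimately show ?case by blast
  qed
  then show ?thesis using that by blast
qed

section \<open>Counting zeros by growth\<close>

text \<open>
  A substitute for Jensen's formula: on the circle of radius \<open>3 * R\<close> each factor \<open>z - zs i\<close> has
  modulus at least \<open>2 * R\<close>, while at the origin it has modulus at most \<open>R\<close>.
\<close>

lemma power_card_zeros_le:
  fixes f :: "complex \<Rightarrow> complex" and zs :: "'i \<Rightarrow> complex"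
  assumes hol: "f holomorphic_on UNIV" and nz: "f 0 \<noteq> 0" and fin: "finite I" and R: "R > 0"
    and ord: "\<And>i. i \<in> I \<Longrightarrow> int (card {j \<in> I. zs j = zs i}) \<le> zorder f (zs i)"
    and zs: "\<And>i. i \<in> I \<Longrightarrow> norm (zs i) \<le> R"
    and M: "\<And>z. norm z = 3 * R \<Longrightarrow> norm (f z) \<le> M"
  shows "2 ^ card I * norm (f 0) \<le> M"
proof -
  obtain g where g: "g holomorphic_on UNIV" "\<And>z. f z = (\<Prod>i\<in>I. z - zs i) * g z"
    using entire_factor_zeros[OF hol nz fin ord] by metis
  have sphere: "norm (g z) \<le> M / (2 * R) ^ card I" if "norm z = 3 * R" for z
  proof -
    have "(2 * R) ^ card I = (\<Prod>i\<in>I. 2 * R)"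
      by simp
    also have "\<dots> \<le> (\<Prod>i\<in>I. norm (z - zs i))"
    proof (intro prod_mono conjI)
      fix i assume "i \<in> I"
      then show "2 * R \<le> norm (z - zs i)"
        using zs[of i] norm_triangle_ineq2[of z "zs i"] that by simp
    qed (use R in simp)
    also have "\<dots> = norm (\<Prod>i\<in>I. z - zs i)"
      by (simp add: prod_norm)
    finally have "(2 * R) ^ card I * norm (g z) \<le> norm (f z)"
      unfolding g(2) norm_mult by (rule mult_right_mono) simp
    also have "\<dots> \<le> M"
      by (rule M[OF that])
    finally show ?thesis
      using R by (simp add: pos_le_divide_eq mult.commute)
  qed
  have hol_g: "g holomorphic_on A" for A
    using g(1) by (rule holomorphic_on_subset) simp
  have g0: "norm (g 0) \<le> M / (2 * R) ^ card I"
  proof (rule maximum_modulus_frontier[of g "ball 0 (3 * R)"])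
    show "norm (g z) \<le> M / (2 * R) ^ card I" if "z \<in> frontier (ball 0 (3 * R))" for z
      using that R by (intro sphere) simp
  qed (use R in \<open>auto intro: hol_g holomorphic_on_imp_continuous_on\<close>)
  have "norm (f 0) = (\<Prod>i\<in>I. norm (zs i)) * norm (g 0)"
    unfolding g(2) by (simp add: norm_mult flip: prod_norm)
  also have "\<dots> \<le> (\<Prod>i\<in>I. R) * (M / (2 * R) ^ card I)"
    using g0 zs R by (intro mult_mono prod_mono prod_nonneg) auto
  also have "\<dots> = M / 2 ^ card I"
    using R by (simp add: power_mult_distrib)
  finally show ?thesis
    by (simp add: pos_le_divide_eq mult.commute)
qed

text \<open>Restricting the indices to \<open>I\<close> can only lower the count, provided the full
  fibre is finite. It is, because its \<open>card\<close> equals a positive order.\<close>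

lemma card_zero_sequence_le_zorder:
  assumes hol: "f holomorphic_on UNIV" and nz: "f a \<noteq> 0" and seq: "zero_sequence f zs"
  shows "int (card {j \<in> I. zs j = zs i}) \<le> zorder f (zs i)"
proof -
  have f0: "f (zs i) = 0" and card: "int (card {n. zs n = zs i}) = zorder f (zs i)"
    using seq by (auto simp: zero_sequence_def)
  have "frequently (\<lambda>z. f z \<noteq> 0) (at (zs i))"
    by (intro eventually_frequently entire_eventually_nonzero[OF hol nz]) simp
  then have "zorder f (zs i) > 0"
    using zorder_pos_iff[OF hol open_UNIV UNIV_I] f0 by blast
  then have "card {n. zs n = zs i} > 0"
    using card by linarith
  then have "card {j \<in> I. zs j = zs i} \<le> card {n. zs n = zs i}"
    by (intro card_mono) (auto simp: card_gt_0_iff)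
  then show ?thesis
    using card by linarith
qed

lemma exponent_of_convergence_exponential_type:
  assumes hol: "f holomorphic_on UNIV" and nz: "f 0 \<noteq> 0" and seq: "zero_sequence f zs"
    and bound: "\<And>z. norm (f z) \<le> C * exp (K * norm z)"
  shows "exponent_of_convergence zs \<le> 1"
proof -
  have zs_pos: "norm (zs n) > 0" for n
    using seq nz by (auto simp: zero_sequence_def) metis
  have "norm (f 0) \<le> C"
    using bound[of 0] by simp
  then have C: "C > 0"
    using nz by (meson less_le_trans zero_less_norm_iff)
  define B where "B = ln (C / norm (f 0))"
  \<comment> \<open>The disc of radius \<open>norm (zs n)\<close> contains the \<open>n + 1\<close>
    zeros with indices \<open>0\<close> to \<open>n\<close>, by monotonicity of the moduli; the zero
    count is applied to these and logarithms are taken.\<close>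
  have lower: "real (Suc n) * ln 2 \<le> B + 3 * K * norm (zs n)" for n
  proof -
    have "norm (zs i) \<le> norm (zs n)" if "i \<le> n" for i
      using seq that by (auto simp: zero_sequence_def mono_def)
    moreover have "norm (f z) \<le> C * exp (K * (3 * norm (zs n)))"
      if "norm z = 3 * norm (zs n)" for z
      using bound[of z] that by simp
    ultimately have "2 ^ card {..n} * norm (f 0) \<le> C * exp (K * (3 * norm (zs n)))"
      by (intro power_card_zeros_le[where zs = zs, OF hol nz finite_atMost zs_pos]
          card_zero_sequence_le_zorder[OF hol nz seq]) (simp_all only: atMost_iff)
    then have "2 ^ Suc n \<le> C / norm (f 0) * exp (K * (3 * norm (zs n)))"
      using nz by (simp add: field_simps)
    then have "ln (2 ^ Suc n) \<le> ln (C / norm (f 0) * exp (K * (3 * norm (zs n))))"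
      using C nz by (subst ln_le_cancel_iff) auto
    also have "\<dots> = B + K * (3 * norm (zs n))"
      using C nz unfolding B_def by (subst ln_mult) auto
    finally show ?thesis
      by (simp add: ln_realpow mult_ac del: power_Suc)
  qed
  \<comment> \<open>The absolute value covers \<open>K\<close> of either sign, and the added 1 keeps
    \<open>D\<close> positive when \<open>K = 0\<close>. The factor 2 in \<open>c\<close> gives up
    half of the linear growth to absorb the constant \<open>B\<close>.\<close>
  define D where "D = 3 * \<bar>K\<bar> + 1"
  define c where "c = ln 2 / (2 * D)"
  have D: "D > 0" and c: "c > 0"
    by (auto simp: c_def D_def)
  have "eventually (\<lambda>n. real n * ln 2 / 2 \<ge> B) sequentially"
    by real_asymp
  then have linear: "eventually (\<lambda>n. n > 0 \<and> c * real n \<le> norm (zs n)) sequentially"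
    using eventually_gt_at_top[of "0::nat"]
  proof eventually_elim
    case (elim n)
    have "3 * K * norm (zs n) \<le> D * norm (zs n)"
      by (intro mult_right_mono) (auto simp: D_def)
    moreover have "real n * ln 2 \<le> real (Suc n) * ln 2"
      by (intro mult_right_mono) auto
    ultimately have "real n * ln 2 / 2 \<le> D * norm (zs n)"
      using lower[of n] elim by linarith
    then show ?case
      using D elim by (simp add: c_def field_simps)
  qed
  have summable: "summable (\<lambda>n. norm (zs n) powr (-\<tau>))" if "\<tau> > 1" for \<tau>
  proof (rule summable_comparison_test_ev)
    show "summable (\<lambda>n. c powr (-\<tau>) * real n powr (-\<tau>))"
      using that by (intro summable_mult) (simp add: summable_real_powr_iff)
    show "eventually (\<lambda>n. norm (norm (zs n) powr (-\<tau>)) \<le> c powr (-\<tau>) * real n powr (-\<tau>))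
            sequentially"
      using linear
    proof eventually_elim
      case (elim n)
      \<comment> \<open>The negative exponent reverses the inequality; \<open>n > 0\<close> keeps
        the smaller base positive, which matters as \<open>0 powr x = 0\<close>.\<close>
      have "norm (zs n) powr (-\<tau>) \<le> (c * real n) powr (-\<tau>)"
        using elim c that by (intro powr_mono2') auto
      then show ?case
        using c by (simp add: powr_mult)
    qed
  qed
  show ?thesis
  \<comment> \<open>Summability is known only for exponents above 1, so the infimum is compared with
    every \<open>y > 1\<close> instead of with 1 itself.\<close>
  proof (rule dense_ge)
    fix y :: ereal assume "1 < y"
    then obtain \<tau> where \<tau>: "1 < ereal \<tau>" "ereal \<tau> < y"
      using ereal_dense2 by blast
    then have "exponent_of_convergence zs \<le> ereal \<tau>"
      unfolding exponent_of_convergence_def using summable by (intro Inf_lower) auto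
    then show "exponent_of_convergence zs \<le> y"
      using \<tau> by simp
  qed
qed

section \<open>Growth of the confluent hypergeometric function\<close>

text \<open>The quotient is a product of \<open>n\<close> factors
  \<open>(\<alpha> + k) / (\<gamma> + k)\<close>, which tend to 1 and hence have a common bound
  \<open>K\<close>.\<close>

lemma pochhammer_ratio_bound:
  fixes \<alpha> \<gamma> :: complex
  assumes "\<gamma> \<notin> \<int>\<^sub>\<le>\<^sub>0"
  obtains K where "K \<ge> 0" "\<And>n. norm (pochhammer \<alpha> n / pochhammer \<gamma> n) \<le> K ^ n"
proof -
  have nz: "\<gamma> + of_nat n \<noteq> 0" for n
    using assms minus_of_nat_in_nonpos_Ints[of n] by (auto simp flip: eq_neg_iff_add_eq_0)
  have "(\<lambda>n. (\<alpha> + of_nat n) / (\<gamma> + of_nat n)) \<longlonglongrightarrow> 1"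
  proof -
    have *: "(\<lambda>n. x / of_nat n) \<longlonglongrightarrow> 0" for x :: complex
      by (rule lim_const_over_n)
    have "(\<lambda>n. (\<alpha> / of_nat n + 1) / (\<gamma> / of_nat n + 1)) \<longlonglongrightarrow> (0 + 1) / (0 + 1)"
      by (intro tendsto_intros * ) auto
    moreover have "eventually (\<lambda>n. (\<alpha> / of_nat n + 1) / (\<gamma> / of_nat n + 1)
                     = (\<alpha> + of_nat n) / (\<gamma> + of_nat n)) sequentially"
      using eventually_gt_at_top[of 0] by eventually_elim (simp add: divide_add_eq_iff)
    ultimately show ?thesis
      by (simp add: Lim_transform_eventually)
  qed
  then have "Bseq (\<lambda>n. (\<alpha> + of_nat n) / (\<gamma> + of_nat n))"
    by (intro convergent_imp_Bseq convergentI)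
  then obtain K where K: "K > 0" "\<And>n. norm ((\<alpha> + of_nat n) / (\<gamma> + of_nat n)) \<le> K"
    by (auto simp: Bseq_def)
  have "norm (pochhammer \<alpha> n / pochhammer \<gamma> n) \<le> K ^ n" for n
  proof (induction n)
    case (Suc n)
    have "norm (pochhammer \<alpha> (Suc n) / pochhammer \<gamma> (Suc n))
          = norm ((\<alpha> + of_nat n) / (\<gamma> + of_nat n)) * norm (pochhammer \<alpha> n / pochhammer \<gamma> n)"
      by (simp add: pochhammer_Suc norm_mult norm_divide mult.commute)
    also have "\<dots> \<le> K * K ^ n"
      using K Suc by (intro mult_mono) auto
    finally show ?case by simp
  qed simp
  then show ?thesis
    using that[of K] K(1) by simp
qed

text \<open>The series is dominated term by term by the exponential series at
  \<open>K * norm z\<close>, which gives both convergence everywhere and the growth bound.\<close>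

lemma hyp1F1_exponential_type:
  assumes "\<gamma> \<notin> \<int>\<^sub>\<le>\<^sub>0"
  obtains K where "hyp1F1 \<alpha> \<gamma> holomorphic_on UNIV"
    "\<And>z. norm (hyp1F1 \<alpha> \<gamma> z) \<le> exp (K * norm z)"
proof -
  obtain K where K: "K \<ge> 0" "\<And>n. norm (pochhammer \<alpha> n / pochhammer \<gamma> n) \<le> K ^ n"
    using pochhammer_ratio_bound[OF assms] by blast
  define a where "a = (\<lambda>n. pochhammer \<alpha> n / (fact n * pochhammer \<gamma> n))"
  have le: "norm (a n * z ^ n) \<le> (K * norm z) ^ n / fact n" for n z
  proof -
    have "norm (a n * z ^ n) = norm (pochhammer \<alpha> n / pochhammer \<gamma> n) * (norm z ^ n / fact n)"
      by (simp add: a_def norm_mult norm_divide norm_power)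
    also have "\<dots> \<le> K ^ n * (norm z ^ n / fact n)"
      by (intro mult_right_mono K) auto
    finally show ?thesis by (simp add: power_mult_distrib)
  qed
  have exp_sums: "(\<lambda>n. x ^ n / fact n) sums exp x" for x :: real
    using exp_converges[of x] by (simp add: field_simps)
  have summable: "summable (\<lambda>n. norm (a n * z ^ n))" for z
    by (rule summable_comparison_test'[OF sums_summable[OF exp_sums], of 0 _ "K * norm z"])
      (use le in simp)
  have sums: "(\<lambda>n. a n * z ^ n) sums hyp1F1 \<alpha> \<gamma> z" for z
    unfolding hyp1F1_def a_def[symmetric] using summable_norm_cancel[OF summable]
    by (simp add: a_def summable_sums)
  have "norm (hyp1F1 \<alpha> \<gamma> z) \<le> exp (K * norm z)" for z
  proof -
    have "norm (\<Sum>n. a n * z ^ n) \<le> (\<Sum>n. (K * norm z) ^ n / fact n)"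
      by (rule norm_suminf_le[OF le sums_summable[OF exp_sums]])
    then show ?thesis
      using sums_unique[OF sums] sums_unique[OF exp_sums] by simp
  qed
  moreover have "hyp1F1 \<alpha> \<gamma> holomorphic_on UNIV"
  proof -
    have "hyp1F1 \<alpha> \<gamma> holomorphic_on ball 0 r" for r
      by (rule power_series_holomorphic[where a = a]) (use sums in simp)
    then have "hyp1F1 \<alpha> \<gamma> holomorphic_on (\<Union>r. ball 0 r)"
      by (intro holomorphic_on_UN_open) auto
    moreover have "(\<Union>r. ball (0::complex) r) = UNIV"
      by (auto intro: gt_ex)
    ultimately show ?thesis by simp
  qed
  ultimately show ?thesis using that by blast
qed

theorem corollary1p5:
  fixes \<alpha> \<gamma> :: complex and zs :: "nat \<Rightarrow> complex"
  assumes "\<alpha> \<notin> \<int>\<^sub>\<le>\<^sub>0" and "\<gamma> \<notin> \<int>\<^sub>\<le>\<^sub>0" and "\<gamma> - \<alpha> \<notin> \<int>\<^sub>\<le>\<^sub>0"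
    and "zero_sequence (hyp1F1 \<alpha> \<gamma>) zs"
  shows "exponent_of_convergence zs \<le> 1"
proof -
  obtain K where K: "hyp1F1 \<alpha> \<gamma> holomorphic_on UNIV"
      "\<And>z. norm (hyp1F1 \<alpha> \<gamma> z) \<le> exp (K * norm z)"
    using hyp1F1_exponential_type[OF assms(2)] by blast
  \<comment> \<open>Only the constant term survives at the origin, so the origin is not a
    zero.\<close>
  have "hyp1F1 \<alpha> \<gamma> 0 = 1"
    using powser_zero[of "\<lambda>n. pochhammer \<alpha> n / (fact n * pochhammer \<gamma> n)"]
    by (simp add: hyp1F1_def)
  then show ?thesis
    using exponent_of_convergence_exponential_type[OF K(1) _ assms(4), where C = 1 and K = K] K(2)
    by simp
qed

end
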